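(* Let $S$ be a uniform semigroup with $|S|\ge 2$ and let $E(S)$ be its set of idempotents. If $E(S)\neq\emptyset$, then $E(S)$ (with the multiplication of $S$) has one of the following structures: (i) $E(S)=L$ or $E(S)=L^1$, where $L$ is a two-element left zero semigroup; (ii) $E(S)=R$ or $E(S)=R^0$, where $R$ is a right zero semigroup.
   Context: A right $S$-act is a nonempty set $A$ with a map $A\times S\to A$, $(a,s)\mapsto as$, with $a(st)=(as)t$. A subact is a nonempty subset closed under the action; an $S$-homomorphism is a map $f$ with $f(as)=f(a)s$; a monomorphism is an injective $S$-homomorphism. A subact is nonzero if it is not a one-element subact. A subact $B$ of $A$ is large in $A$ if every $S$-homomorphism $g:A\to C$ (for any right $S$-act $C$) whose restriction to $B$ is injective is itself injective. A right $S$-act is uniform if every nonzero subact is large in it. A semigroup $S$ is uniform (i.e. right uniform) if the right $S$-act $S_S$ ($S$ acting on itself by right multiplication; its subacts are the nonempty right ideals) is uniform. A left (right) zero semigroup is one with $xy=x$ (respectively $xy=y$) for all $x,y$. $L^1=L\cup\{1\}$ is $L$ with a new identity element adjoined, and $R^0=R\cup\{0\}$ is $R$ with a new zero element adjoined (also when $R$ is a singleton). *)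

theory Defs
  imports Main
begin

locale right_act =
  fixes A :: "'a set" and act :: "'a \<Rightarrow> 's::semigroup_mult \<Rightarrow> 'a"
  assumes nonempty: "A \<noteq> {}"
    and act_closed: "a \<in> A \<Longrightarrow> act a s \<in> A"
    and act_mult: "a \<in> A \<Longrightarrow> act a (s * t) = act (act a s) t"

definition subact :: "'a set \<Rightarrow> 'a set \<Rightarrow> ('a \<Rightarrow> 's::semigroup_mult \<Rightarrow> 'a) \<Rightarrow> bool" where
  "subact B A act \<longleftrightarrow> B \<noteq> {} \<and> B \<subseteq> A \<and> (\<forall>b\<in>B. \<forall>s. act b s \<in> B)"

definition act_hom ::
    "'a set \<Rightarrow> ('a \<Rightarrow> 's::semigroup_mult \<Rightarrow> 'a) \<Rightarrow> 'c set \<Rightarrow> ('c \<Rightarrow> 's \<Rightarrow> 'c) \<Rightarrow> ('a \<Rightarrow> 'c) \<Rightarrow> bool" where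
  "act_hom A actA C actC f \<longleftrightarrow>
     f ` A \<subseteq> C \<and> (\<forall>a\<in>A. \<forall>s. f (actA a s) = actC (f a) s)"

text \<open>
  A definition cannot quantify over the type carrying the codomain \<open>C\<close>, so \<open>C\<close> ranges over the acts
  carried by subsets of the type of \<open>A\<close>. Nothing is lost: the image of a homomorphism on \<open>A\<close> is
  isomorphic to an act carried by a system of representatives inside \<open>A\<close>. The lemma
  \<open>large_inj_on\<close> below gives the property for codomains of arbitrary type.
\<close>

definition large :: "'a set \<Rightarrow> 'a set \<Rightarrow> ('a \<Rightarrow> 's::semigroup_mult \<Rightarrow> 'a) \<Rightarrow> bool" where
  "large B A act \<longleftrightarrow> subact B A act \<and>
     (\<forall>(C :: 'a set) actC g. right_act C actC \<longrightarrow> act_hom A act C actC g \<longrightarrow>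
        inj_on g B \<longrightarrow> inj_on g A)"

lemma large_inj_on:
  fixes A :: "'a set" and act :: "'a \<Rightarrow> 's::semigroup_mult \<Rightarrow> 'a"
    and C :: "'c set" and actC :: "'c \<Rightarrow> 's \<Rightarrow> 'c"
  assumes A: "right_act A act" and large: "large B A act"
    and hom: "act_hom A act C actC g" and inj: "inj_on g B"
  shows "inj_on g A"
proof -
  interpret right_act A act by fact
  define h where "h = (\<lambda>a. inv_into A g (g a))"
  have hA: "h a \<in> A" and gh: "g (h a) = g a" if "a \<in> A" for a
    using that by (auto simp: h_def inv_into_into f_inv_into_f)
  have h_eq: "h a = h b" if "g a = g b" for a b
    using that by (simp add: h_def)
  have g_act: "g (act a s) = actC (g a) s" if "a \<in> A" for a s
    using hom that by (simp add: act_hom_def)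
  have h_act: "h (act (h a) s) = h (act a s)" if "a \<in> A" for a s
    using that by (intro h_eq) (simp add: g_act gh hA)
  have h_act2: "h (act (act (h a) s) t) = h (act (act a s) t)" if "a \<in> A" for a s t
    using that by (intro h_eq) (simp add: g_act gh hA act_closed)
  have "right_act (h ` A) (\<lambda>a s. h (act a s))"
    by unfold_locales (auto simp: nonempty hA act_closed act_mult h_act h_act2)
  moreover have "act_hom A act (h ` A) (\<lambda>a s. h (act a s)) h"
    by (auto simp: act_hom_def h_act)
  moreover have "inj_on h B"
    using inj gh large by (metis inj_on_def large_def subact_def subsetD)
  ultimately have "inj_on h A"
    using large unfolding large_def by blast
  then show ?thesis
    using h_eq by (meson inj_on_def)
qed

definition uniform_act :: "'a set \<Rightarrow> ('a \<Rightarrow> 's::semigroup_mult \<Rightarrow> 'a) \<Rightarrow> bool" where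
  "uniform_act A act \<longleftrightarrow> right_act A act \<and>
     (\<forall>B. subact B A act \<and> \<not> is_singleton B \<longrightarrow> large B A act)"

definition uniform_semigroup :: "'s::semigroup_mult itself \<Rightarrow> bool" where
  "uniform_semigroup _ \<longleftrightarrow> uniform_act (UNIV :: 's set) (*)"

definition idempotents :: "'s::semigroup_mult set" where
  "idempotents = {e. e * e = e}"

text \<open>The following concern subsets of a semigroup under the inherited multiplication.\<close>

definition left_zero_semigroup :: "'s::semigroup_mult set \<Rightarrow> bool" where
  "left_zero_semigroup L \<longleftrightarrow> L \<noteq> {} \<and> (\<forall>x\<in>L. \<forall>y\<in>L. x * y = x)"

definition right_zero_semigroup :: "'s::semigroup_mult set \<Rightarrow> bool" where
  "right_zero_semigroup R \<longleftrightarrow> R \<noteq> {} \<and> (\<forall>x\<in>R. \<forall>y\<in>R. x * y = y)"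

text \<open>\<open>T = L\<^sup>1\<close>: the identity \<open>u\<close> is one for \<open>T\<close>, not necessarily for the ambient semigroup.\<close>

definition adjoin_one :: "'s::semigroup_mult set \<Rightarrow> 's set \<Rightarrow> bool" where
  "adjoin_one L T \<longleftrightarrow> (\<exists>u. u \<notin> L \<and> T = L \<union> {u} \<and> (\<forall>x\<in>T. u * x = x \<and> x * u = x))"

text \<open>\<open>T = R\<^sup>0\<close>, likewise.\<close>

definition adjoin_zero :: "'s::semigroup_mult set \<Rightarrow> 's set \<Rightarrow> bool" where
  "adjoin_zero R T \<longleftrightarrow> (\<exists>z. z \<notin> R \<and> T = R \<union> {z} \<and> (\<forall>x\<in>T. z * x = z \<and> x * z = z))"

end

(*
  Left multiplication by an idempotent e is an endomorphism of the right act S that is injective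
  on eS. So if eS is not a singleton then it is large, the endomorphism is injective, and e is a
  left identity of S; otherwise e is a left zero. There are at most two left zeros: if a, b, c are
  distinct left zeros, the right congruence that only identifies a and c is trivial on the right
  ideal {a, b}. If there are two left zeros a, b then there is at most one left identity, because
  identifying two left identities is a right congruence that is trivial on {a, b}.
*)
theory Submission
  imports Defs
begin

text \<open>The premise \<open>congruence\<close> says that identifying \<open>x\<close> with
  \<open>y\<close> and nothing else is compatible with the action. The quotient map is not
  injective, so by largeness it cannot be injective on \<open>B\<close>, and only the pair
  \<open>x\<close>, \<open>y\<close> can be the obstruction.\<close>

lemma large_collapse_pair:
  assumes A: "right_act A act" and B: "large B A act"
    and x: "x \<in> A" and y: "y \<in> A" and "x \<noteq> y"
    and congruence: "\<And>s. act x s = act y s \<or> act x s \<in> {x, y} \<and> act y s \<in> {x, y}"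
  shows "x \<in> B \<and> y \<in> B"
proof (rule ccontr)
  assume not_both: "\<not> (x \<in> B \<and> y \<in> B)"
  interpret right_act A act by fact
  \<comment> \<open>The quotient is realised inside \<open>A\<close>: \<open>x\<close> represents
    the class of \<open>x\<close> and \<open>y\<close>, and the new action is the old one followed
    by \<open>g\<close>.\<close>
  define g where "g = (\<lambda>a. if a = y then x else a)"
  have g_act: "g (act (g a) s) = g (act a s)" for a s
    using congruence[of s] by (auto simp: g_def)
  have g_mem: "g a \<in> A" if "a \<in> A" for a
    using that x by (simp add: g_def)
  have "right_act A (\<lambda>a s. g (act a s))"
    by unfold_locales (simp_all add: nonempty act_closed act_mult g_mem g_act)
  moreover have "act_hom A act A (\<lambda>a s. g (act a s)) g"
    by (auto simp: act_hom_def g_act g_mem)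
  ultimately have "inj_on g A" if "inj_on g B"
    using B that unfolding large_def by blast
  moreover have "inj_on g B"
    using not_both by (auto simp: inj_on_def g_def)
  moreover have "g x = g y"
    by (simp add: g_def)
  ultimately show False
    using x y \<open>x \<noteq> y\<close> by (meson inj_onD)
qed

locale right_uniform_semigroup =
  fixes S :: "'s::semigroup_mult itself"
  assumes uniform: "uniform_semigroup S"
begin

lemma right_act_mult: "right_act (UNIV :: 's set) (*)"
  using uniform by (simp add: uniform_semigroup_def uniform_act_def)

lemma large_right_ideal:
  fixes B :: "'s set"
  assumes "subact B UNIV (*)" and "\<not> is_singleton B"
  shows "large B UNIV (*)"
  using uniform assms by (simp add: uniform_semigroup_def uniform_act_def)

lemma idempotent_left_zero_or_left_identity:
  fixes e :: 's
  assumes e: "e * e = e"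
  shows "(\<forall>s. e * s = e) \<or> (\<forall>s. e * s = s)"
proof (cases "is_singleton (range ((*) e))")
  case True
  then obtain c where "range ((*) e) = {c}"
    by (auto simp: is_singleton_def)
  then have "e * s = c" for s
    by blast
  \<comment> \<open>The constant value is \<open>c = e * e = e\<close>.\<close>
  then show ?thesis
    using e by metis
next
  case False
  have idem: "e * (e * s) = e * s" for s
    using e by (metis mult.assoc)
  have "subact (range ((*) e)) UNIV (*)"
    by (auto simp: subact_def mult.assoc)
  then have "large (range ((*) e)) UNIV (*)"
    using False by (rule large_right_ideal)
  moreover have "act_hom UNIV (*) UNIV (*) ((*) e)"
    by (simp add: act_hom_def mult.assoc)
  moreover have "inj_on ((*) e) (range ((*) e))"
    by (auto simp: inj_on_def idem)
  ultimately have "inj ((*) e)"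
    using large_inj_on[OF right_act_mult] by blast
  \<comment> \<open>Injectivity cancels the outer \<open>e\<close> in \<open>idem\<close>.\<close>
  then show ?thesis
    using idem by (metis injD)
qed

lemma large_left_zero_pair:
  fixes a b :: 's
  assumes "\<And>s. a * s = a" and "\<And>s. b * s = b" and "a \<noteq> b"
  shows "large {a, b} UNIV (*)"
  by (rule large_right_ideal) (use assms in \<open>auto simp: subact_def is_singleton_def\<close>)

lemma left_zero_in_pair:
  fixes a b c :: 's
  assumes "\<And>s. a * s = a" and "\<And>s. b * s = b" and "\<And>s. c * s = c" and "a \<noteq> b"
  shows "c \<in> {a, b}"
  using large_collapse_pair[OF right_act_mult large_left_zero_pair, of a b a c] assms by auto

lemma left_identity_unique:
  fixes a b e f :: 's
  assumes "\<And>s. a * s = a" and "\<And>s. b * s = b" and "a \<noteq> b"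
    and "\<And>s. e * s = s" and "\<And>s. f * s = s"
  shows "e = f"
proof (rule ccontr)
  assume "e \<noteq> f"
  then have "e \<in> {a, b}"
    using large_collapse_pair[OF right_act_mult large_left_zero_pair, of a b e f] assms by auto
  \<comment> \<open>Now \<open>e\<close> is both a left zero and a left identity, so
    \<open>a = e * a = e = e * b = b\<close>.\<close>
  then show False
    using assms by (metis insertE singletonD)
qed

end

theorem proposition2p9:
  assumes "uniform_semigroup TYPE('s::semigroup_mult)"
    and "\<exists>x y :: 's. x \<noteq> y"
    and "(idempotents :: 's set) \<noteq> {}"
  shows "(\<exists>L :: 's set. left_zero_semigroup L \<and> card L = 2 \<and>
            (idempotents = L \<or> adjoin_one L idempotents)) \<or>
         (\<exists>R :: 's set. right_zero_semigroup R \<and>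
            (idempotents = R \<or> adjoin_zero R idempotents))"
proof -
  interpret right_uniform_semigroup "TYPE('s)"
    by unfold_locales fact
  define Z :: "'s set" where "Z = {z. \<forall>s. z * s = z}"
  define I :: "'s set" where "I = {e. \<forall>s. e * s = s}"
  have E: "idempotents = Z \<union> I"
    using idempotent_left_zero_or_left_identity
    by (auto simp: idempotents_def Z_def I_def)
  have disjoint: "Z \<inter> I = {}"
  proof (rule equals0I)
    fix x assume "x \<in> Z \<inter> I"
    \<comment> \<open>Both expressions for \<open>x * s\<close> agree, so the semigroup would be
      trivial.\<close>
    then have "s = x" for s
      by (metis (mono_tags) IntE Z_def I_def mem_Collect_eq)
    then show False
      using assms(2) by metis
  qed
  have right_zero: "right_zero_semigroup I" if "I \<noteq> {}"
    using that by (simp add: right_zero_semigroup_def I_def)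
  consider "Z = {}" | z where "Z = {z}" | a b where "a \<in> Z" "b \<in> Z" "a \<noteq> b"
    by blast
  then show ?thesis
  proof cases
    case 1
    then show ?thesis
      using E assms(3) right_zero by auto
  next
    case (2 z)
    then have z: "z * s = z" for s
      by (auto simp: Z_def)
    show ?thesis
    proof (cases "I = {}")
      case True
      then have "idempotents = {z}"
        using E 2 by simp
      \<comment> \<open>With no left identity, \<open>R\<close> has to be \<open>{z}\<close> itself:
        \<open>I\<close> is empty and cannot serve as \<open>R\<close>.\<close>
      moreover have "right_zero_semigroup {z}"
        using z by (simp add: right_zero_semigroup_def)
      ultimately show ?thesis
        by blast
    next
      case False
      have "adjoin_zero I idempotents"
        unfolding adjoin_zero_def
        \<comment> \<open>The left zero \<open>z\<close> is also a right zero element of the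
          idempotents, since those in \<open>I\<close> fix it from the left.\<close>
        by (rule exI[of _ z]) (use z disjoint in \<open>auto simp: E 2 I_def\<close>)
      then show ?thesis
        using right_zero[OF False] by blast
    qed
  next
    case (3 a b)
    then have zero: "a * s = a" "b * s = b" for s
      by (auto simp: Z_def)
    have Z: "Z = {a, b}"
      using 3 left_zero_in_pair[of a b] by (auto simp: Z_def)
    have L: "left_zero_semigroup Z" "card Z = 2"
      using \<open>a \<noteq> b\<close> zero by (auto simp: left_zero_semigroup_def Z)
    show ?thesis
    proof (cases "I = {}")
      case True
      then show ?thesis
        using E L by auto
    next
      case False
      then obtain u where u: "u \<in> I"
        by blast
      then have "I = {u}"
        using left_identity_unique[OF zero \<open>a \<noteq> b\<close>] by (auto simp: I_def)
      then have "adjoin_one Z idempotents"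
        unfolding adjoin_one_def
        \<comment> \<open>The left identity \<open>u\<close> is two-sided here: left zeros absorb
          \<open>u\<close> on the right, and \<open>u * u = u\<close>.\<close>
        by (intro exI[of _ u]) (use u disjoint in \<open>auto simp: E I_def Z_def\<close>)
      then show ?thesis
        using L by blast
    qed
  qed
qed

end
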